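(* Let $A$ and $B$ be Banach algebras with bounded approximate identities and let $(E^{<},E^{>})$ be a Morita equivalence between them. Let $I$ be a closed two-sided ideal of $B$ and set $J=\operatorname{Ind}_B^A(I)$. Then $$J=\overline{\operatorname{span}}\,{}_A\langle E^{>}I,E^{<}\rangle=\overline{\operatorname{span}}\,{}_A\langle E^{>},IE^{<}\rangle=\overline{\operatorname{span}}\,{}_A\langle E^{>},{}_IE^{<}\rangle.$$ In particular, $J$ is a closed two-sided ideal of $A$.
   Context: All Banach spaces and Banach algebras are complex, and all Banach module actions are contractive. For a subset $S$ of a Banach space, $\overline{\operatorname{span}}\,S$ is its closed linear span. For sets $S,T$ a pairing symbol applied to $(S,T)$ denotes the set of all values on $S\times T$; juxtaposition of linear subspaces (e.g. $E^{>}I$, $IE^{<}$) denotes the linear span of all products. A bounded approximate identity in a Banach algebra $A$ is a net $(u_\lambda)$ with $\sup_\lambda\|u_\lambda\|<\infty$ and $u_\lambda a\to a$, $au_\lambda\to a$ for every $a\in A$. A Morita equivalence $(E^{<},E^{>})$ between Banach algebras $A$ and $B$ consists of a Banach $B$-$A$-bimodule $E^{<}$, a Banach $A$-$B$-bimodule $E^{>}$, and continuous bilinear pairings $\langle\cdot,\cdot\rangle_B:E^{<}\times E^{>}\to B$ and ${}_A\langle\cdot,\cdot\rangle:E^{>}\times E^{<}\to A$ of norm at most one such that, for all $e^{<},f^{<}\in E^{<}$, $e^{>},f^{>}\in E^{>}$, $a\in A$, $b\in B$: (i) $\langle be^{<},e^{>}\rangle_B=b\langle e^{<},e^{>}\rangle_B$,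 $\langle e^{<},e^{>}b\rangle_B=\langle e^{<},e^{>}\rangle_Bb$, ${}_A\langle ae^{>},e^{<}\rangle=a\,{}_A\langle e^{>},e^{<}\rangle$, ${}_A\langle e^{>},e^{<}a\rangle={}_A\langle e^{>},e^{<}\rangle a$; (ii) $\langle e^{<}a,e^{>}\rangle_B=\langle e^{<},ae^{>}\rangle_B$, ${}_A\langle e^{>}b,e^{<}\rangle={}_A\langle e^{>},be^{<}\rangle$; (iii) $\langle e^{<},e^{>}\rangle_Bf^{<}=e^{<}\,{}_A\langle e^{>},f^{<}\rangle$, $e^{>}\langle f^{<},f^{>}\rangle_B={}_A\langle e^{>},f^{<}\rangle f^{>}$; (iv) both pairings are full: $\overline{\operatorname{span}}\,\langle E^{<},E^{>}\rangle_B=B$ and $\overline{\operatorname{span}}\,{}_A\langle E^{>},E^{<}\rangle=A$; (v) all four module actions are nondegenerate, i.e. the linear span of the module products is dense in the module. For a closed two-sided ideal $I$ of $B$ put $E_I^{>}=\{\xi\in E^{>}:\langle\eta,\xi\rangle_B\in I\ \forall\eta\in E^{<}\}$, ${}_IE^{<}=\{\eta\in E^{<}:\langle\eta,\xi\rangle_B\in I\ \forall\xi\in E^{>}\}$ and, by definition, $\operatorname{Ind}_B^A(I)=\overline{\operatorname{span}}\,{}_A\langle E_I^{>},E^{<}\rangle$. *)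

theory Defs
  imports "HOL-Analysis.Analysis"
begin

section \<open>Complex Banach spaces and Banach algebras\<close>

class complex_banach = banach +
  fixes scaleC :: "complex \<Rightarrow> 'a \<Rightarrow> 'a"
  assumes scaleC_add_right: "scaleC c (x + y) = scaleC c x + scaleC c y"
    and scaleC_add_left: "scaleC (c + d) x = scaleC c x + scaleC d x"
    and scaleC_scaleC: "scaleC c (scaleC d x) = scaleC (c * d) x"
    and scaleC_of_real: "scaleC (complex_of_real r) x = r *\<^sub>R x"
    and norm_scaleC: "norm (scaleC c x) = cmod c * norm x"

text \<open>Algebras are neither assumed unital nor commutative; submultiplicativity of the norm
  is part of \<^class>\<open>real_normed_algebra\<close>.\<close>

class complex_banach_algebra = complex_banach + real_normed_algebra +
  assumes mult_scaleC_left: "scaleC c x * y = scaleC c (x * y)"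
    and mult_scaleC_right: "x * scaleC c y = scaleC c (x * y)"

lemma vector_space_scaleC: "vector_space (scaleC :: complex \<Rightarrow> 'a \<Rightarrow> 'a::complex_banach)"
proof
  show "scaleC 1 x = x" for x :: 'a
    using scaleC_of_real[of 1 x] by simp
qed (simp_all add: scaleC_add_right scaleC_add_left scaleC_scaleC)

abbreviation csubspace :: "'a::complex_banach set \<Rightarrow> bool" where
  "csubspace \<equiv> module.subspace scaleC"

abbreviation cspan :: "'a::complex_banach set \<Rightarrow> 'a set" where
  "cspan \<equiv> module.span scaleC"

abbreviation clinear :: "('a::complex_banach \<Rightarrow> 'b::complex_banach) \<Rightarrow> bool" where
  "clinear \<equiv> Vector_Spaces.linear scaleC scaleC"

definition closed_cspan :: "'a::complex_banach set \<Rightarrow> 'a set" where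
  "closed_cspan S = closure (cspan S)"

definition contractive_bilinear ::
    "('a::complex_banach \<Rightarrow> 'b::complex_banach \<Rightarrow> 'c::complex_banach) \<Rightarrow> bool" where
  "contractive_bilinear f \<longleftrightarrow>
     (\<forall>x. clinear (f x)) \<and> (\<forall>y. clinear (\<lambda>x. f x y)) \<and>
     (\<forall>x y. norm (f x y) \<le> norm x * norm y)"

definition values_on :: "('a \<Rightarrow> 'b \<Rightarrow> 'c) \<Rightarrow> 'a set \<Rightarrow> 'b set \<Rightarrow> 'c set" where
  "values_on f S T = {f x y | x y. x \<in> S \<and> y \<in> T}"

definition closed_ideal :: "'a::complex_banach_algebra set \<Rightarrow> bool" where
  "closed_ideal I \<longleftrightarrow>
     csubspace I \<and> closed I \<and> (\<forall>x\<in>I. \<forall>a. a * x \<in> I \<and> x * a \<in> I)"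

section \<open>Bounded approximate identities\<close>

text \<open>A net is a function on a directed preordered index type; it converges along the
  filter generated by the tails of the index type.\<close>

definition directed_preorder :: "('i \<Rightarrow> 'i \<Rightarrow> bool) \<Rightarrow> bool" where
  "directed_preorder le \<longleftrightarrow> reflp le \<and> transp le \<and> (\<forall>i j. \<exists>k. le i k \<and> le j k)"

definition tails :: "('i \<Rightarrow> 'i \<Rightarrow> bool) \<Rightarrow> 'i filter" where
  "tails le = (INF i. principal {j. le i j})"

lemma eventually_tails:
  assumes "directed_preorder le"
  shows "eventually P (tails le) \<longleftrightarrow> (\<exists>i. \<forall>j. le i j \<longrightarrow> P j)"
proof -
  have "\<exists>k\<in>UNIV. principal {l. le k l} \<le> inf (principal {l. le i l}) (principal {l. le j l})"
    for i j
  proof -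
    obtain k where "le i k" "le j k"
      using assms unfolding directed_preorder_def by blast
    then have "{l. le k l} \<subseteq> {l. le i l} \<inter> {l. le j l}"
      using assms unfolding directed_preorder_def by (auto dest: transpD)
    then show ?thesis by auto
  qed
  then show ?thesis
    unfolding tails_def by (subst eventually_INF_base) (auto simp: eventually_principal)
qed

definition bounded_approximate_identity ::
    "('i \<Rightarrow> 'i \<Rightarrow> bool) \<Rightarrow> ('i \<Rightarrow> 'a::complex_banach_algebra) \<Rightarrow> bool" where
  "bounded_approximate_identity le u \<longleftrightarrow>
     directed_preorder le \<and> bounded (range u) \<and>
     (\<forall>a. ((\<lambda>i. u i * a) \<longlongrightarrow> a) (tails le) \<and> ((\<lambda>i. a * u i) \<longlongrightarrow> a) (tails le))"

section \<open>Banach bimodules and Morita equivalences\<close>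

locale banach_bimodule =
  fixes lact :: "'a::complex_banach_algebra \<Rightarrow> 'e::complex_banach \<Rightarrow> 'e"
    and ract :: "'e \<Rightarrow> 'b::complex_banach_algebra \<Rightarrow> 'e"
  assumes lact_contractive: "contractive_bilinear lact"
    and ract_contractive: "contractive_bilinear ract"
    and lact_assoc: "lact (a * a') x = lact a (lact a' x)"
    and ract_assoc: "ract x (b * b') = ract (ract x b) b'"
    and lact_ract: "ract (lact a x) b = lact a (ract x b)"

text \<open>The type \<open>'l\<close> is the \<open>B\<close>-\<open>A\<close>-bimodule $E^{<}$, with actions \<open>bl\<close> of \<open>B\<close>
  and \<open>la\<close> of \<open>A\<close>; the type \<open>'r\<close> is the \<open>A\<close>-\<open>B\<close>-bimodule $E^{>}$, with actions
  \<open>ar\<close> of \<open>A\<close> and \<open>rb\<close> of \<open>B\<close>.  The \<open>B\<close>-valued pairing is \<open>pB\<close>, the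
  \<open>A\<close>-valued one \<open>pA\<close>.\<close>

locale morita_equivalence =
  L: banach_bimodule bl la + R: banach_bimodule ar rb
  for bl :: "'b::complex_banach_algebra \<Rightarrow> 'l::complex_banach \<Rightarrow> 'l"
    and la :: "'l \<Rightarrow> 'a::complex_banach_algebra \<Rightarrow> 'l"
    and ar :: "'a \<Rightarrow> 'r::complex_banach \<Rightarrow> 'r"
    and rb :: "'r \<Rightarrow> 'b \<Rightarrow> 'r" +
  fixes pB :: "'l \<Rightarrow> 'r \<Rightarrow> 'b"
    and pA :: "'r \<Rightarrow> 'l \<Rightarrow> 'a"
  assumes pB_contractive: "contractive_bilinear pB"
    and pA_contractive: "contractive_bilinear pA"
    and pB_left: "pB (bl b e) x = b * pB e x"
    and pB_right: "pB e (rb x b) = pB e x * b"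
    and pA_left: "pA (ar a x) e = a * pA x e"
    and pA_right: "pA x (la e a) = pA x e * a"
    and pB_balanced: "pB (la e a) x = pB e (ar a x)"
    and pA_balanced: "pA (rb x b) e = pA x (bl b e)"
    and linking_left: "bl (pB e x) f = la e (pA x f)"
    and linking_right: "rb x (pB f y) = ar (pA x f) y"
    and pB_full: "closed_cspan (values_on pB UNIV UNIV) = UNIV"
    and pA_full: "closed_cspan (values_on pA UNIV UNIV) = UNIV"
    and bl_nondegenerate: "closed_cspan (values_on bl UNIV UNIV) = UNIV"
    and la_nondegenerate: "closed_cspan (values_on la UNIV UNIV) = UNIV"
    and ar_nondegenerate: "closed_cspan (values_on ar UNIV UNIV) = UNIV"
    and rb_nondegenerate: "closed_cspan (values_on rb UNIV UNIV) = UNIV"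

text \<open>\<open>right_part pB I\<close> is $E_I^{>}$ and \<open>left_part pB I\<close> is ${}_I E^{<}$.\<close>

definition right_part :: "('l \<Rightarrow> 'r \<Rightarrow> 'b) \<Rightarrow> 'b set \<Rightarrow> 'r set" where
  "right_part pB I = {x. \<forall>e. pB e x \<in> I}"

definition left_part :: "('l \<Rightarrow> 'r \<Rightarrow> 'b) \<Rightarrow> 'b set \<Rightarrow> 'l set" where
  "left_part pB I = {e. \<forall>x. pB e x \<in> I}"

definition induced_ideal ::
    "('l \<Rightarrow> 'r \<Rightarrow> 'b) \<Rightarrow> ('r \<Rightarrow> 'l \<Rightarrow> 'a::complex_banach) \<Rightarrow> 'b set \<Rightarrow> 'a set" where
  "induced_ideal pB pA I = closed_cspan (values_on pA (right_part pB I) UNIV)"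

end

theory Submission
  imports Defs
begin

text \<open>Since \<open>A\<close> has a bounded approximate identity \<open>(u\<^sub>i)\<close> and acts nondegenerately,
  \<open>u\<^sub>i \<xi> \<rightarrow> \<xi>\<close> for every \<open>\<xi>\<close> in $E^{>}$. By fullness each \<open>u\<^sub>i\<close> is a limit of sums of values
  ${}_A\langle\zeta,\eta\rangle$, and ${}_A\langle\zeta,\eta\rangle\xi = \zeta\langle\eta,\xi\rangle_B$.
  So every \<open>\<xi>\<close> in $E_I^{>}$ lies in $\overline{\operatorname{span}}\,E^{>}I$, and symmetrically
  every element of ${}_IE^{<}$ lies in $\overline{\operatorname{span}}\,IE^{<}$. The spaces
  $E^{>}I$ and $IE^{<}$ are linked by the balancing of the \<open>A\<close>-valued pairing over \<open>B\<close>.\<close>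

section \<open>Closed complex spans and extension by density\<close>

interpretation cvs: vector_space "scaleC :: complex \<Rightarrow> 'a \<Rightarrow> 'a::complex_banach"
  by (rule vector_space_scaleC)

text \<open>Real scaling is complex scaling by \<open>complex_of_real r\<close>, so complex
  linearity includes real linearity. This gives access to continuity results stated for real bounded
  linear maps.\<close>

lemma clinear_bounded_linear:
  assumes f: "clinear f" and bound: "\<And>x. norm (f x) \<le> norm x * K"
  shows "bounded_linear f"
proof -
  interpret f: Vector_Spaces.linear scaleC scaleC f by (rule f)
  show ?thesis
    by (intro bounded_linear_intro[where K = K] f.add bound)
      (metis f.scale scaleC_of_real)
qed

lemma bounded_linear_scaleC: "bounded_linear (scaleC c :: 'a \<Rightarrow> 'a::complex_banach)"
proof (rule bounded_linear_intro[where K = "cmod c"])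
  show "scaleC c (r *\<^sub>R x) = r *\<^sub>R scaleC c x" for r and x :: 'a
    by (simp add: scaleC_scaleC mult.commute flip: scaleC_of_real)
qed (simp_all add: scaleC_add_right norm_scaleC mult.commute)

lemma closed_cspan_superset: "S \<subseteq> closed_cspan S"
  unfolding closed_cspan_def using cvs.span_superset closure_subset by blast

lemma closed_closed_cspan: "closed (closed_cspan S)"
  by (simp add: closed_cspan_def)

lemma csubspace_closed_cspan: "csubspace (closed_cspan S)"
proof (rule cvs.subspaceI)
  show "0 \<in> closed_cspan S"
    unfolding closed_cspan_def using cvs.span_zero closure_subset by blast
next
  fix x y assume "x \<in> closed_cspan S" "y \<in> closed_cspan S"
  then obtain f g where fg: "\<And>n. f n \<in> cspan S" "f \<longlonglongrightarrow> x" "\<And>n. g n \<in> cspan S" "g \<longlonglongrightarrow> y"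
    unfolding closed_cspan_def closure_sequential by blast
  then have "(\<lambda>n. f n + g n) \<longlonglongrightarrow> x + y" "\<And>n. f n + g n \<in> cspan S"
    by (auto intro: tendsto_add cvs.span_add)
  then show "x + y \<in> closed_cspan S"
    unfolding closed_cspan_def closure_sequential by (intro exI[of _ "\<lambda>n. f n + g n"]) simp
next
  fix c x assume "x \<in> closed_cspan S"
  then obtain f where f: "\<And>n. f n \<in> cspan S" "f \<longlonglongrightarrow> x"
    unfolding closed_cspan_def closure_sequential by blast
  then have "(\<lambda>n. scaleC c (f n)) \<longlonglongrightarrow> scaleC c x" "\<And>n. scaleC c (f n) \<in> cspan S"
    by (auto intro: bounded_linear.tendsto[OF bounded_linear_scaleC] cvs.span_scale)
  then show "scaleC c x \<in> closed_cspan S"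
    unfolding closed_cspan_def closure_sequential by (intro exI[of _ "\<lambda>n. scaleC c (f n)"]) simp
qed

lemma cspan_subset_closed_cspan: "cspan S \<subseteq> closed_cspan S"
  by (simp add: closed_cspan_def closure_subset)

lemma closed_cspan_cspan [simp]: "closed_cspan (cspan S) = closed_cspan S"
  by (simp add: closed_cspan_def cvs.span_span)

lemma closed_cspan_minimal:
  assumes "S \<subseteq> T" "csubspace T" "closed T"
  shows "closed_cspan S \<subseteq> T"
  unfolding closed_cspan_def by (intro closure_minimal cvs.span_minimal assms)

lemma closed_cspan_subsetI: "S \<subseteq> closed_cspan T \<Longrightarrow> closed_cspan S \<subseteq> closed_cspan T"
  by (intro closed_cspan_minimal csubspace_closed_cspan closed_closed_cspan)

text \<open>The preimage of a closed subspace under a continuous linear map is a closed subspace, so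
  membership need only be checked on generators. The later density arguments for single maps go
  through this.\<close>

lemma clinear_closed_cspan:
  assumes f: "clinear f" "bounded_linear f"
    and T: "csubspace T" "closed T"
    and S: "\<And>y. y \<in> S \<Longrightarrow> f y \<in> T"
    and x: "x \<in> closed_cspan S"
  shows "f x \<in> T"
proof -
  interpret f: Vector_Spaces.linear scaleC scaleC f by (rule f)
  have "closed_cspan S \<subseteq> f -` T"
  proof (rule closed_cspan_minimal)
    show "S \<subseteq> f -` T" using S by blast
    show "csubspace (f -` T)" by (rule f.subspace_vimage[OF T(1)])
    show "closed (f -` T)"
      using T(2) f(2) by (intro closed_vimage) (simp_all add: linear_continuous_on)
  qed
  then show ?thesis using x by blast
qed

section \<open>Values of contractive bilinear maps\<close>

lemma values_onI: "x \<in> S \<Longrightarrow> y \<in> T \<Longrightarrow> f x y \<in> values_on f S T"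
  unfolding values_on_def by blast

lemma values_on_subset_iff: "values_on f S T \<subseteq> X \<longleftrightarrow> (\<forall>x\<in>S. \<forall>y\<in>T. f x y \<in> X)"
  unfolding values_on_def by blast

lemma values_onE:
  assumes "z \<in> values_on f S T"
  obtains x y where "x \<in> S" "y \<in> T" "z = f x y"
  using assms unfolding values_on_def by blast

lemma contractive_bilinearD:
  assumes "contractive_bilinear f"
  shows "clinear (f x)" "clinear (\<lambda>x. f x y)" "norm (f x y) \<le> norm x * norm y"
    "bounded_linear (f x)" "bounded_linear (\<lambda>x. f x y)"
proof -
  show *: "clinear (f x)" "clinear (\<lambda>x. f x y)" "norm (f x y) \<le> norm x * norm y" for x y
    using assms unfolding contractive_bilinear_def by blast+
  show "bounded_linear (f x)"
    by (rule clinear_bounded_linear[where K = "norm x"]) (use * in \<open>simp_all add: mult.commute\<close>)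
  show "bounded_linear (\<lambda>x. f x y)"
    by (rule clinear_bounded_linear[OF *(2) *(3)])
qed

lemma contractive_bilinear_flip:
  "contractive_bilinear f \<Longrightarrow> contractive_bilinear (\<lambda>x y. f y x)"
  unfolding contractive_bilinear_def by (auto simp: mult.commute)

text \<open>Extends one variable at a time: first in \<open>x\<close> with \<open>t\<close> in
  \<open>T\<close> fixed, then in \<open>y\<close>.\<close>

lemma contractive_bilinear_closed_cspan:
  assumes f: "contractive_bilinear f"
    and x: "x \<in> closed_cspan S" and y: "y \<in> closed_cspan T"
  shows "f x y \<in> closed_cspan (values_on f S T)"
proof (rule clinear_closed_cspan[OF contractive_bilinearD(1)[OF f] contractive_bilinearD(4)[OF f]
      csubspace_closed_cspan closed_closed_cspan _ y])
  fix t assume "t \<in> T"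
  then show "f x t \<in> closed_cspan (values_on f S T)"
    by (intro clinear_closed_cspan[OF contractive_bilinearD(2)[OF f] contractive_bilinearD(5)[OF f]
          csubspace_closed_cspan closed_closed_cspan _ x] subsetD[OF closed_cspan_superset])
      (auto simp: values_on_def)
qed

section \<open>Approximate identities acting on modules\<close>

text \<open>The vectors on which \<open>T i\<close> tends to the identity form a subspace, and the
  bound uniform in \<open>i\<close> makes it closed. Convergence on generators therefore
  suffices.\<close>

lemma uniformly_bounded_tendsto_closed_cspan:
  fixes T :: "'i \<Rightarrow> 'e::complex_banach \<Rightarrow> 'e"
  assumes lin: "\<And>i. clinear (T i)"
    and bound: "\<And>i x. norm (T i x) \<le> M * norm x"
    and lim: "\<And>s. s \<in> S \<Longrightarrow> ((\<lambda>i. T i s) \<longlongrightarrow> s) F"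
    and x: "x \<in> closed_cspan S"
  shows "((\<lambda>i. T i x) \<longlongrightarrow> x) F"
proof -
  let ?V = "{x. ((\<lambda>i. T i x) \<longlongrightarrow> x) F}"
  note hom = module_hom.add module_hom.scale module_hom.diff module_hom.zero
  have T: "module_hom scaleC scaleC (T i)" for i
    by (rule Vector_Spaces.linear.axioms(3)[OF lin])
  have "closed_cspan S \<subseteq> ?V"
  proof (rule closed_cspan_minimal)
    show "S \<subseteq> ?V" using lim by blast
    show "csubspace ?V"
      by (rule cvs.subspaceI)
        (auto simp: hom[OF T] intro: tendsto_add bounded_linear.tendsto[OF bounded_linear_scaleC])
    show "closed ?V"
      unfolding closed_sequential_limits
    proof (intro allI impI, elim conjE)
      fix g y assume g: "\<forall>n. g n \<in> ?V" and y: "g \<longlonglongrightarrow> y"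
      have "\<forall>\<^sub>F i in F. dist (T i y) y < e" if "e > 0" for e
      proof -
        \<comment> \<open>The approximation error \<open>g n - y\<close> enters twice: through
          \<open>T i\<close>, at cost \<open>\<bar>M\<bar>\<close>, and directly, at cost 1. The
          absolute value covers a negative \<open>M\<close> and keeps \<open>K\<close> positive for
          the division.\<close>
        define K where "K = \<bar>M\<bar> + 1"
        have K: "K > 0" by (simp add: K_def add_nonneg_pos)
        with y \<open>e > 0\<close> obtain n where n: "dist (g n) y < e / 2 / K"
          by (meson divide_pos_pos half_gt_zero order_refl metric_LIMSEQ_D)
        have "\<forall>\<^sub>F i in F. dist (T i (g n)) (g n) < e / 2"
          using g \<open>e > 0\<close> by (intro tendstoD) simp_all
        then show ?thesis
        proof eventually_elim
          case (elim i)
          have eq: "T i y - y = T i (y - g n) + (T i (g n) - g n) + (g n - y)"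
            by (simp add: hom[OF T])
          have "norm (T i y - y) \<le> norm (T i (y - g n)) + norm (T i (g n) - g n) + norm (g n - y)"
            unfolding eq by (rule order_trans[OF norm_triangle_ineq add_right_mono[OF norm_triangle_ineq]])
          moreover have "norm (T i (y - g n)) \<le> \<bar>M\<bar> * norm (g n - y)"
            by (rule order_trans[OF bound]) (simp add: mult_right_mono norm_minus_commute)
          moreover have "\<bar>M\<bar> * norm (g n - y) + norm (g n - y) < e / 2"
            using n K by (simp add: K_def dist_norm field_simps)
          ultimately show ?case using elim unfolding dist_norm by linarith
        qed
      qed
      then show "y \<in> ?V" by (simp add: tendsto_iff)
    qed
  qed
  then show ?thesis using x by blast
qed

text \<open>Nondegeneracy makes the products \<open>f a y\<close> span densely, and boundedness of
  \<open>u\<close> supplies the uniform bound. Convergence on products is a premise, not derived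
  from an associativity law, so that \<open>f\<close> can be a left action or a flipped right
  action.\<close>

lemma approximate_identity_action_tendsto:
  assumes f: "contractive_bilinear f" and "bounded (range u)"
    and nondeg: "closed_cspan (values_on f UNIV UNIV) = UNIV"
    and lim: "\<And>a y. ((\<lambda>i. f (u i) (f a y)) \<longlongrightarrow> f a y) F"
  shows "((\<lambda>i. f (u i) x) \<longlongrightarrow> x) F"
proof -
  obtain M where M: "\<And>i. norm (u i) \<le> M"
    using \<open>bounded (range u)\<close> by (auto simp: bounded_iff)
  show ?thesis
  proof (rule uniformly_bounded_tendsto_closed_cspan[where T = "\<lambda>i. f (u i)"])
    show "clinear (f (u i))" for i by (rule contractive_bilinearD[OF f])
    show "norm (f (u i) y) \<le> M * norm y" for i y
      by (rule order_trans[OF contractive_bilinearD(3)[OF f]]) (simp add: M mult_right_mono)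
    show "x \<in> closed_cspan (values_on f UNIV UNIV)" by (simp add: nondeg)
  qed (auto simp: values_on_def lim)
qed

lemma tails_neq_bot: "directed_preorder le \<Longrightarrow> tails le \<noteq> bot"
  by (auto simp: trivial_limit_def eventually_tails directed_preorder_def dest: reflpD)

text \<open>Since \<open>S\<close> generates the algebra, every \<open>f a x\<close> lies in the
  closed span of the orbit of \<open>x\<close> under \<open>S\<close>. Taking \<open>a = u i\<close>
  and passing to the limit puts \<open>x\<close> there too.\<close>

lemma mem_closed_cspan_orbit:
  assumes f: "contractive_bilinear f" and u: "bounded_approximate_identity le u"
    and nondeg: "closed_cspan (values_on f UNIV UNIV) = UNIV"
    and lim: "\<And>a y. ((\<lambda>i. f (u i) (f a y)) \<longlongrightarrow> f a y) (tails le)"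
    and S: "closed_cspan S = UNIV"
  shows "x \<in> closed_cspan ((\<lambda>a. f a x) ` S)"
proof (rule Lim_in_closed_set)
  have "f a x \<in> closed_cspan ((\<lambda>a. f a x) ` S)" for a
    by (rule clinear_closed_cspan[OF contractive_bilinearD(2)[OF f] contractive_bilinearD(5)[OF f]
          csubspace_closed_cspan closed_closed_cspan, where S = S])
      (auto simp: S intro: subsetD[OF closed_cspan_superset])
  then show "\<forall>\<^sub>F i in tails le. f (u i) x \<in> closed_cspan ((\<lambda>a. f a x) ` S)"
    by simp
  show "((\<lambda>i. f (u i) x) \<longlongrightarrow> x) (tails le)"
    using u by (intro approximate_identity_action_tendsto[OF f _ nondeg lim])
      (simp add: bounded_approximate_identity_def)
  show "tails le \<noteq> bot"
    using u by (intro tails_neq_bot) (simp add: bounded_approximate_identity_def)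
qed (rule closed_closed_cspan)

section \<open>The submodules attached to an ideal and the induced ideal\<close>

context morita_equivalence
begin

lemma right_part_subset:
  assumes u: "bounded_approximate_identity le (u :: 'i \<Rightarrow> 'a)"
  shows "right_part pB I \<subseteq> closed_cspan (values_on rb UNIV I)"
proof
  fix x assume x: "x \<in> right_part pB I"
  \<comment> \<open>Associativity turns \<open>ar (u i) (ar a y)\<close> into
    \<open>ar (u i * a) y\<close>, and the action is continuous in its algebra variable.\<close>
  have "((\<lambda>i. ar (u i) (ar a y)) \<longlongrightarrow> ar a y) (tails le)" for a y
    unfolding R.lact_assoc[symmetric] using u
    by (intro bounded_linear.tendsto[OF contractive_bilinearD(5)[OF R.lact_contractive]])
      (simp add: bounded_approximate_identity_def)
  then have "x \<in> closed_cspan ((\<lambda>a. ar a x) ` values_on pA UNIV UNIV)"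
    by (rule mem_closed_cspan_orbit[OF R.lact_contractive u ar_nondegenerate _ pA_full])
  \<comment> \<open>By \<open>linking_right\<close>, \<open>ar (pA z e) x = rb z (pB e x)\<close>,
    where \<open>pB e x\<close> lies in \<open>I\<close>.\<close>
  also have "\<dots> \<subseteq> closed_cspan (values_on rb UNIV I)"
    using x by (intro closed_cspan_subsetI subset_trans[OF _ closed_cspan_superset])
      (auto simp: right_part_def values_onI elim!: values_onE simp flip: linking_right)
  finally show "x \<in> closed_cspan (values_on rb UNIV I)" .
qed

lemma left_part_subset:
  assumes u: "bounded_approximate_identity le (u :: 'i \<Rightarrow> 'a)"
  shows "left_part pB I \<subseteq> closed_cspan (values_on bl I UNIV)"
proof
  fix e assume e: "e \<in> left_part pB I"
  have "((\<lambda>i. la (la y a) (u i)) \<longlongrightarrow> la y a) (tails le)" for a y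
    unfolding L.ract_assoc[symmetric] using u
    by (intro bounded_linear.tendsto[OF contractive_bilinearD(4)[OF L.ract_contractive]])
      (simp add: bounded_approximate_identity_def)
  \<comment> \<open>The general lemma expects the algebra variable first; flipping \<open>la\<close>
    leaves its set of values unchanged.\<close>
  moreover have "values_on (\<lambda>a y. la y a) UNIV UNIV = values_on la UNIV UNIV"
    by (auto simp: values_on_def)
  ultimately have "e \<in> closed_cspan (la e ` values_on pA UNIV UNIV)"
    using mem_closed_cspan_orbit[OF contractive_bilinear_flip[OF L.ract_contractive] u _ _ pA_full]
    by (simp add: la_nondegenerate)
  also have "\<dots> \<subseteq> closed_cspan (values_on bl I UNIV)"
    using e by (intro closed_cspan_subsetI subset_trans[OF _ closed_cspan_superset])
      (auto simp: left_part_def values_onI elim!: values_onE simp flip: linking_left)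
  finally show "e \<in> closed_cspan (values_on bl I UNIV)" .
qed

text \<open>Reduces comparisons between spans of pairing values to comparisons of the factors, each
  up to closed span.\<close>

lemma closed_cspan_pA_le:
  assumes "X \<subseteq> closed_cspan S" "Y \<subseteq> closed_cspan T"
  shows "closed_cspan (values_on pA X Y) \<subseteq> closed_cspan (values_on pA S T)"
  using assms by (intro closed_cspan_subsetI)
    (auto simp: values_on_subset_iff intro!: contractive_bilinear_closed_cspan[OF pA_contractive])

text \<open>Moving \<open>b\<close> across the pairing matches the generators of the two sides.
  Replacing a factor by its span does not affect the closed span of the values.\<close>

lemma closed_cspan_pA_balanced:
  "closed_cspan (values_on pA (cspan (values_on rb UNIV I)) UNIV) =
   closed_cspan (values_on pA UNIV (cspan (values_on bl I UNIV)))"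
proof -
  have "pA (rb x b) e \<in> values_on pA UNIV (values_on bl I UNIV)"
    "pA x (bl b e) \<in> values_on pA (values_on rb UNIV I) UNIV" if "b \<in> I" for x b e
    using that by (simp add: pA_balanced values_onI) (simp add: that values_onI flip: pA_balanced)
  then have "values_on pA (values_on rb UNIV I) UNIV = values_on pA UNIV (values_on bl I UNIV)"
    by (intro antisym; unfold values_on_subset_iff) (auto elim!: values_onE)
  moreover have "closed_cspan (values_on pA (cspan S) (cspan T)) = closed_cspan (values_on pA S T)"
    for S T
    by (intro antisym closed_cspan_pA_le cspan_subset_closed_cspan)
      (simp_all add: closed_cspan_superset)
  from this[of _ UNIV] this[of UNIV] have
    "closed_cspan (values_on pA (cspan S) UNIV) = closed_cspan (values_on pA S UNIV)"
    "closed_cspan (values_on pA UNIV (cspan T)) = closed_cspan (values_on pA UNIV T)" for S T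
    by simp_all
  ultimately show ?thesis by simp
qed

text \<open>On generators, left multiplication by \<open>a\<close> moves into the first argument,
  where \<open>right_part pB I\<close> is stable because
  \<open>pB e (ar a x) = pB (la e a) x\<close>. Right multiplication moves into the second,
  unrestricted argument.\<close>

lemma closed_ideal_induced_ideal:
  assumes "closed_ideal I"
  shows "closed_ideal (induced_ideal pB pA I)"
  unfolding closed_ideal_def induced_ideal_def
proof (intro conjI ballI allI)
  let ?S = "values_on pA (right_part pB I) UNIV"
  show "csubspace (closed_cspan ?S)" by (rule csubspace_closed_cspan)
  show "closed (closed_cspan ?S)" by (rule closed_closed_cspan)
  \<comment> \<open>Viewing multiplication as a contractive bilinear map lets the density lemma
    extend absorption from generators to the closed span.\<close>
  have mult: "contractive_bilinear ((*) :: 'a \<Rightarrow> 'a \<Rightarrow> 'a)"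
    unfolding contractive_bilinear_def
    by (auto intro!: Vector_Spaces.linear.intro vector_space_scaleC module_hom.intro
        module_hom_axioms.intro cvs.module_axioms
        simp: algebra_simps mult_scaleC_left mult_scaleC_right norm_mult_ineq)
  fix z a assume z: "z \<in> closed_cspan ?S"
  have part: "ar a x \<in> right_part pB I" if "x \<in> right_part pB I" for x
    using that by (simp add: right_part_def flip: pB_balanced)
  show "a * z \<in> closed_cspan ?S"
    by (rule clinear_closed_cspan[OF contractive_bilinearD(1)[OF mult]
          contractive_bilinearD(4)[OF mult] csubspace_closed_cspan closed_closed_cspan _ z])
      (auto intro!: subsetD[OF closed_cspan_superset] values_onI part elim!: values_onE
        simp flip: pA_left)
  show "z * a \<in> closed_cspan ?S"
    by (rule clinear_closed_cspan[OF contractive_bilinearD(2)[OF mult]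
          contractive_bilinearD(5)[OF mult] csubspace_closed_cspan closed_closed_cspan _ z])
      (auto intro!: subsetD[OF closed_cspan_superset] values_onI elim!: values_onE
        simp flip: pA_right)
qed

text \<open>Products lie in \<open>right_part pB I\<close> since
  \<open>pB e (rb x b) = pB e x * b\<close> and \<open>I\<close> absorbs multiplication from the
  left. The span follows because that set is an intersection of preimages of \<open>I\<close> under
  linear maps.\<close>

lemma cspan_subset_right_part:
  assumes "closed_ideal I"
  shows "cspan (values_on rb UNIV I) \<subseteq> right_part pB I"
proof (rule cvs.span_minimal)
  show "values_on rb UNIV I \<subseteq> right_part pB I"
    using assms by (auto simp: values_on_def right_part_def pB_right closed_ideal_def)
  have "right_part pB I = (\<Inter>e. pB e -` I)"
    by (auto simp: right_part_def)
  then show "csubspace (right_part pB I)"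
    using assms pB_contractive unfolding closed_ideal_def
    by (auto intro!: cvs.subspace_Inter module_hom.subspace_vimage
        Vector_Spaces.linear.axioms(3) contractive_bilinearD)
qed

lemma cspan_subset_left_part:
  assumes "closed_ideal I"
  shows "cspan (values_on bl I UNIV) \<subseteq> left_part pB I"
proof (rule cvs.span_minimal)
  show "values_on bl I UNIV \<subseteq> left_part pB I"
    using assms by (auto simp: values_on_def left_part_def pB_left closed_ideal_def)
  have "left_part pB I = (\<Inter>x. (\<lambda>e. pB e x) -` I)"
    by (auto simp: left_part_def)
  then show "csubspace (left_part pB I)"
    using assms pB_contractive unfolding closed_ideal_def
    by (auto intro!: cvs.subspace_Inter module_hom.subspace_vimage
        Vector_Spaces.linear.axioms(3) contractive_bilinearD)
qed

end

theorem proposition2p7: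
  fixes leA :: "'i \<Rightarrow> 'i \<Rightarrow> bool" and uA :: "'i \<Rightarrow> 'a::complex_banach_algebra"
    and leB :: "'j \<Rightarrow> 'j \<Rightarrow> bool" and uB :: "'j \<Rightarrow> 'b::complex_banach_algebra"
    and bl :: "'b \<Rightarrow> 'l::complex_banach \<Rightarrow> 'l" and la :: "'l \<Rightarrow> 'a \<Rightarrow> 'l"
    and ar :: "'a \<Rightarrow> 'r::complex_banach \<Rightarrow> 'r" and rb :: "'r \<Rightarrow> 'b \<Rightarrow> 'r"
    and pB :: "'l \<Rightarrow> 'r \<Rightarrow> 'b" and pA :: "'r \<Rightarrow> 'l \<Rightarrow> 'a"
    and I :: "'b set" and J :: "'a set"
  assumes "bounded_approximate_identity leA uA"
    and "bounded_approximate_identity leB uB"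
    and "morita_equivalence bl la ar rb pB pA"
    and "closed_ideal I"
    and "J = induced_ideal pB pA I"
  shows "J = closed_cspan (values_on pA (cspan (values_on rb UNIV I)) UNIV) \<and>
    J = closed_cspan (values_on pA UNIV (cspan (values_on bl I UNIV))) \<and>
    J = closed_cspan (values_on pA UNIV (left_part pB I)) \<and>
    closed_ideal J"
proof -
  interpret morita_equivalence bl la ar rb pB pA by fact
  note u = \<open>bounded_approximate_identity leA uA\<close> and I = \<open>closed_ideal I\<close>
  \<comment> \<open>\<open>right_part pB I\<close> contains the span of the products and lies in its
    closed span, so both give the same closed span after pairing.\<close>
  have "J = closed_cspan (values_on pA (cspan (values_on rb UNIV I)) UNIV)"
    unfolding assms(5) induced_ideal_def
    by (intro antisym closed_cspan_pA_le closed_cspan_superset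
        order_trans[OF cspan_subset_right_part[OF I] closed_cspan_superset]
        order_trans[OF right_part_subset[OF u] equalityD2[OF closed_cspan_cspan]])
  \<comment> \<open>The same squeeze in the left module compares the last two spans with each other;
    \<open>closed_cspan_pA_balanced\<close> then ties them to \<open>J\<close>.\<close>
  moreover have "closed_cspan (values_on pA UNIV (left_part pB I)) =
      closed_cspan (values_on pA UNIV (cspan (values_on bl I UNIV)))"
    by (intro antisym closed_cspan_pA_le closed_cspan_superset
        order_trans[OF cspan_subset_left_part[OF I] closed_cspan_superset]
        order_trans[OF left_part_subset[OF u] equalityD2[OF closed_cspan_cspan]])
  ultimately show ?thesis
    using closed_ideal_induced_ideal[OF I] assms(5) by (simp add: closed_cspan_pA_balanced)
qed

end
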